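(* For every $f\in\mathrm{Diff}^1_+([0,1])$ and every $\epsilon>0$ there exists $g\in F$ such that $\|f-g\|<\epsilon$. Similarly, for every $f\in\mathrm{Diff}^1_+(\mathbb{S}^1)$ and every $\epsilon>0$ there exists $g\in T$ such that $\|f-g\|<\epsilon$.
   Context: $\mathrm{Diff}^1_+([0,1])$ and $\mathrm{Diff}^1_+(\mathbb{S}^1)$ denote the groups of orientation-preserving $C^1$-diffeomorphisms of $[0,1]$ and of the circle $\mathbb{S}^1=\mathbb{R}/\mathbb{Z}$ (the interval $[0,1]$ with endpoints identified). A dyadic rational is a number $m/2^k$ with $m\in\mathbb{Z}$, $k\in\mathbb{N}$. A breakpoint of a piecewise linear function is a point where it is not differentiable. Thompson's group $F$ is the group of piecewise linear homeomorphisms $g$ of $[0,1]$ (orientation-preserving, with finitely many breakpoints) whose breakpoints are dyadic rationals and whose derivatives on intervals of differentiability are integer powers of $2$. Thompson's group $T$ is the group of orientation-preserving piecewise linear homeomorphisms of $\mathbb{S}^1$ (with finitely many breakpoints) whose breakpoints are dyadic rationals, which map dyadic rationals to dyadic rationals, and whose derivatives on intervals of differentiability are integer powers of $2$. $\|f\|=\sup_x|f(x)|$ is the $C^0$-norm. For the circle, an orientation-preserving homeomorphism $f$ of $\mathbb{S}^1$ is identified with a lift, a homeomorphism $\tilde f\colon\mathbb{R}\to\mathbb{R}$ with $\tilde f(x+1)=\tilde f(x)+1$, and $\|f-g\|<\epsilon$ means that $\sup_{x\in[0,1]}|\tilde f(x)-\tilde g(x)|<\epsilon$ for suitable lifts $\tilde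 f,\tilde g$. *)

theory Defs
  imports "HOL-Analysis.Analysis"
begin

definition dyadics :: "real set" where
  "dyadics = {x. \<exists>(m::int) (k::nat). x = of_int m / 2 ^ k}"

definition sup_norm_on :: "real set \<Rightarrow> (real \<Rightarrow> real) \<Rightarrow> real" where
  "sup_norm_on I f = (SUP x\<in>I. \<bar>f x\<bar>)"

(* Derivatives are taken within I, hence one-sided at the endpoints of a closed interval;
   C1_differentiable_on uses two-sided derivatives even there. *)
definition C1_on :: "real set \<Rightarrow> (real \<Rightarrow> real) \<Rightarrow> bool" where
  "C1_on I f \<longleftrightarrow>
     (\<exists>f'. (\<forall>x\<in>I. (f has_real_derivative f' x) (at x within I)) \<and> continuous_on I f')"

definition breakpoints :: "real set \<Rightarrow> (real \<Rightarrow> real) \<Rightarrow> real set" where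
  "breakpoints I f = {x \<in> I. \<not> f differentiable (at x within I)}"

(* Continuous, and affine on every closed subinterval whose interior avoids a finite set P. *)
definition piecewise_linear_on :: "real set \<Rightarrow> (real \<Rightarrow> real) \<Rightarrow> bool" where
  "piecewise_linear_on I f \<longleftrightarrow>
     continuous_on I f \<and>
     (\<exists>P. finite P \<and>
        (\<forall>a b. a \<le> b \<and> {a..b} \<subseteq> I \<and> {a<..<b} \<inter> P = {} \<longrightarrow>
           (\<exists>m c. \<forall>x\<in>{a..b}. f x = m * x + c)))"

definition power_of_two_slopes_on :: "real set \<Rightarrow> (real \<Rightarrow> real) \<Rightarrow> bool" where
  "power_of_two_slopes_on I f \<longleftrightarrow>
     (\<forall>x\<in>I. \<forall>d. (f has_real_derivative d) (at x within I) \<longrightarrow> (\<exists>k::int. d = 2 powi k))"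

(* A self-map of [0,1] is a function real => real of which only the values on [0,1] matter. *)

definition homeo_plus_interval :: "(real \<Rightarrow> real) set" where
  "homeo_plus_interval =
     {f. homeomorphism {0..1} {0..1} f (inv_into {0..1} f) \<and> strict_mono_on {0..1} f}"

definition diff1_plus_interval :: "(real \<Rightarrow> real) set" where
  "diff1_plus_interval =
     {f \<in> homeo_plus_interval. C1_on {0..1} f \<and> C1_on {0..1} (inv_into {0..1} f)}"

definition thompson_F :: "(real \<Rightarrow> real) set" where
  "thompson_F =
     {g \<in> homeo_plus_interval.
        piecewise_linear_on {0..1} g \<and>
        breakpoints {0..1} g \<subseteq> dyadics \<and>
        power_of_two_slopes_on {0..1} g}"

quotient_type circle = real / "\<lambda>x y :: real. x - y \<in> \<int>"
  morphisms rep_circle to_circle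
proof (rule equivpI)
  show "reflp (\<lambda>x y :: real. x - y \<in> \<int>)"
    by (simp add: reflp_def)
  show "symp (\<lambda>x y :: real. x - y \<in> \<int>)"
    by (metis (mono_tags, lifting) Ints_minus minus_diff_eq sympI)
  show "transp (\<lambda>x y :: real. x - y \<in> \<int>)"
  proof (rule transpI)
    fix x y z :: real
    assume "x - y \<in> \<int>" "y - z \<in> \<int>"
    then have "(x - y) + (y - z) \<in> \<int>" by (rule Ints_add)
    then show "x - z \<in> \<int>" by simp
  qed
qed

(* F is a lift of the circle map f. The circle maps that have such a lift are exactly the
   orientation-preserving homeomorphisms of the circle. The lift is unique up to adding an
   integer constant, so the conditions on lifts below do not depend on its choice. *)
definition circle_lift :: "(circle \<Rightarrow> circle) \<Rightarrow> (real \<Rightarrow> real) \<Rightarrow> bool" where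
  "circle_lift f F \<longleftrightarrow>
     homeomorphism UNIV UNIV F (inv F) \<and>
     (\<forall>x. F (x + 1) = F x + 1) \<and>
     (\<forall>x. f (to_circle x) = to_circle (F x))"

definition diff1_plus_circle :: "(circle \<Rightarrow> circle) set" where
  "diff1_plus_circle =
     {f. \<exists>F. circle_lift f F \<and> C1_on UNIV F \<and> C1_on UNIV (inv F)}"

(* Piecewise linearity, with its finiteness requirement, is imposed on one period of the lift.
   Breakpoints and slopes are those of the lift on the whole line, so that 0 and 1 get
   two-sided derivatives. *)
definition thompson_T :: "(circle \<Rightarrow> circle) set" where
  "thompson_T =
     {g. \<exists>G. circle_lift g G \<and>
        piecewise_linear_on {0..1} G \<and>
        breakpoints UNIV G \<subseteq> dyadics \<and>
        G ` dyadics \<subseteq> dyadics \<and>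
        power_of_two_slopes_on UNIV G}"

definition circle_C0_close :: "(circle \<Rightarrow> circle) \<Rightarrow> (circle \<Rightarrow> circle) \<Rightarrow> real \<Rightarrow> bool" where
  "circle_C0_close f g \<epsilon> \<longleftrightarrow>
     (\<exists>F G. circle_lift f F \<and> circle_lift g G \<and> sup_norm_on {0..1} (\<lambda>x. F x - G x) < \<epsilon>)"

end

(* Any dyadic interval is mapped onto any other one by a piecewise linear map with at most two
   pieces, whose slopes are the two powers of 2 around the ratio of the lengths. Given an increasing
   continuous f, choose dyadic values y_i in ]f(x_{i-1}), f(x_i)[ on a fine dyadic grid x_i and glue
   such maps [x_i, x_{i+1}] -> [y_i, y_{i+1}]; monotonicity of both functions controls their
   distance between the grid points. For the circle, a lift is first moved by a small translation
   so that its value at 0 is dyadic, and the approximation on [0,1] is then extended periodically. *)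

theory Submission
  imports Defs
begin

section \<open>Dyadic rationals: ring operations and density\<close>

lemma dyadicsI: "x = of_int m / 2 ^ k \<Longrightarrow> x \<in> dyadics"
  by (auto simp: dyadics_def)

lemma dyadicsE:
  assumes "x \<in> dyadics"
  obtains m :: int and k :: nat where "x = of_int m / 2 ^ k"
  using assms by (auto simp: dyadics_def)

lemma dyadics_of_int [simp]: "of_int m \<in> dyadics"
  by (rule dyadicsI[of _ m 0]) simp

lemma dyadics_0 [simp]: "0 \<in> dyadics"
  using dyadics_of_int[of 0] by simp

lemma dyadics_1 [simp]: "1 \<in> dyadics"
  using dyadics_of_int[of 1] by simp

lemma dyadics_add:
  assumes "x \<in> dyadics" "y \<in> dyadics"
  shows "x + y \<in> dyadics"
proof -
  obtain m k m' k' where "x = of_int m / 2 ^ k" "y = of_int m' / 2 ^ k'"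
    using assms by (elim dyadicsE)
  then have "x + y = of_int (m * 2 ^ k' + m' * 2 ^ k) / 2 ^ (k + k')"
    by (simp add: add_divide_distrib power_add)
  then show ?thesis by (rule dyadicsI)
qed

lemma dyadics_mult:
  assumes "x \<in> dyadics" "y \<in> dyadics"
  shows "x * y \<in> dyadics"
proof -
  obtain m k m' k' where "x = of_int m / 2 ^ k" "y = of_int m' / 2 ^ k'"
    using assms by (elim dyadicsE)
  then have "x * y = of_int (m * m') / 2 ^ (k + k')"
    by (simp add: power_add)
  then show ?thesis by (rule dyadicsI)
qed

lemma dyadics_diff: "x \<in> dyadics \<Longrightarrow> y \<in> dyadics \<Longrightarrow> x - y \<in> dyadics"
  using dyadics_add[of x "of_int (-1) * y"] dyadics_mult[of "of_int (-1)" y] dyadics_of_int[of "-1"]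
  by simp

lemma dyadics_two_powi [simp]: "2 powi k \<in> dyadics"
proof (cases "k \<ge> 0")
  case True
  show ?thesis
    by (rule dyadicsI[of _ "2 ^ nat k" 0]) (use True in \<open>simp add: power_int_def\<close>)
next
  case False
  show ?thesis
    by (rule dyadicsI[of _ 1 "nat (- k)"]) (use False in \<open>simp add: power_int_def field_simps\<close>)
qed

lemma dyadics_dense:
  assumes "a < b"
  obtains d where "d \<in> dyadics" "a < d" "d < b"
proof -
  obtain k where "1 / (b - a) < 2 ^ k"
    using real_arch_pow[of 2 "1 / (b - a)"] by auto
  then have k: "1 < (b - a) * 2 ^ k"
    using assms by (simp add: field_simps)
  \<comment> \<open>This is the least multiple of \<open>1 / 2 ^ k\<close> above \<open>a\<close>.
    It exceeds \<open>a\<close> by at most \<open>1 / 2 ^ k\<close>, which is less than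
    \<open>b - a\<close>.\<close>
  define d :: real where "d = of_int (\<lfloor>a * 2 ^ k\<rfloor> + 1) / 2 ^ k"
  have "d * 2 ^ k = of_int (\<lfloor>a * 2 ^ k\<rfloor> + 1)" by (simp add: d_def)
  moreover have "a * 2 ^ k < of_int (\<lfloor>a * 2 ^ k\<rfloor> + 1)" "of_int (\<lfloor>a * 2 ^ k\<rfloor> + 1) \<le> a * 2 ^ k + 1"
    by linarith+
  ultimately have "a * 2 ^ k < d * 2 ^ k" "d * 2 ^ k < b * 2 ^ k"
    using k unfolding left_diff_distrib by linarith+
  then have "a < d" "d < b" by simp_all
  moreover have "d \<in> dyadics" unfolding d_def by (rule dyadicsI) (rule refl)
  ultimately show ?thesis using that by blast
qed

section \<open>Dyadic piecewise linear maps on a closed interval\<close>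

lemma strict_mono_on_Icc_less:
  fixes f :: "real \<Rightarrow> real"
  assumes "strict_mono_on {a..b} f" "a \<le> x" "x < y" "y \<le> b"
  shows "f x < f y"
  using assms by (intro strict_mono_onD[OF assms(1)]) auto

lemma strict_mono_on_Icc_le:
  fixes f :: "real \<Rightarrow> real"
  assumes "strict_mono_on {a..b} f" "a \<le> x" "x \<le> y" "y \<le> b"
  shows "f x \<le> f y"
  using assms strict_mono_on_Icc_less[of a b f x y] by (cases "x = y") auto

text \<open>This strengthens the format of \<open>piecewise_linear_on\<close>: the exceptional
  points, the slopes and the constant terms are all restricted. Dyadic constant terms make the map
  send dyadics to dyadics, as \<open>thompson_T\<close> demands. \<open>P\<close> may contain points
  that are not breakpoints, which makes gluing easy.\<close>

definition dyadic_pl :: "real \<Rightarrow> real \<Rightarrow> (real \<Rightarrow> real) \<Rightarrow> bool" where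
  "dyadic_pl a b g \<longleftrightarrow>
     continuous_on {a..b} g \<and> strict_mono_on {a..b} g \<and>
     (\<exists>P. finite P \<and> P \<subseteq> dyadics \<and>
        (\<forall>x y. x \<le> y \<and> {x..y} \<subseteq> {a..b} \<and> {x<..<y} \<inter> P = {} \<longrightarrow>
           (\<exists>(k::int). \<exists>c\<in>dyadics. \<forall>t\<in>{x..y}. g t = 2 powi k * t + c)))"

lemma dyadic_pl_strict_mono: "dyadic_pl a b g \<Longrightarrow> strict_mono_on {a..b} g"
  by (simp add: dyadic_pl_def)

lemma dyadic_pl_cong:
  assumes "dyadic_pl a b g" "\<And>t. t \<in> {a..b} \<Longrightarrow> h t = g t"
  shows "dyadic_pl a b h"
proof -
  have "continuous_on {a..b} h \<longleftrightarrow> continuous_on {a..b} g"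
    using assms(2) by (intro continuous_on_cong) auto
  moreover have "strict_mono_on {a..b} h \<longleftrightarrow> strict_mono_on {a..b} g"
    using assms(2) by (simp add: strict_mono_on_def)
  moreover have "(\<forall>t\<in>{x..y}. h t = 2 powi k * t + c) \<longleftrightarrow> (\<forall>t\<in>{x..y}. g t = 2 powi k * t + c)"
    if "{x..y} \<subseteq> {a..b}" for x y c and k :: int
    using assms(2) that by (intro ball_cong) auto
  ultimately show ?thesis
    using assms(1) unfolding dyadic_pl_def by (auto 4 4)
qed

lemma dyadic_pl_affine:
  assumes "c \<in> dyadics"
  shows "dyadic_pl a b (\<lambda>t. 2 powi (k::int) * t + c)"
  unfolding dyadic_pl_def using assms
  by (auto intro!: continuous_intros exI[of _ "{}"] simp: strict_mono_on_def)

text \<open>Once \<open>b\<close> joins the two exceptional sets, an interval whose interior avoids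
  them lies on one side of \<open>b\<close>, so one of the two assumptions describes it. Adding
  \<open>b\<close> keeps the set dyadic because \<open>b\<close> is.\<close>

lemma dyadic_pl_glue:
  assumes 1: "dyadic_pl a b g" and 2: "dyadic_pl b c g"
    and ab: "a \<le> b" and bc: "b \<le> c" and b: "b \<in> dyadics"
  shows "dyadic_pl a c g"
proof -
  have un: "{a..c} = {a..b} \<union> {b..c}" using ab bc by auto
  have "continuous_on {a..c} g"
    unfolding un using 1 2 by (intro continuous_on_closed_Un) (auto simp: dyadic_pl_def)
  moreover have "strict_mono_on {a..c} g"
  proof (rule strict_mono_onI)
    fix r s assume rs: "r \<in> {a..c}" "s \<in> {a..c}" "r < s"
    have m1: "g x < g y" if "a \<le> x" "x < y" "y \<le> b" for x y
      using dyadic_pl_strict_mono[OF 1] that by (rule strict_mono_on_Icc_less)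
    have m2: "g x < g y" if "b \<le> x" "x < y" "y \<le> c" for x y
      using dyadic_pl_strict_mono[OF 2] that by (rule strict_mono_on_Icc_less)
    consider "s \<le> b" | "b \<le> r" | "r < b" "b < s" using rs by linarith
    then show "g r < g s"
    proof cases
      case 3
      then show ?thesis using m1[of r b] m2[of b s] rs by auto
    qed (use m1[of r s] m2[of r s] rs in auto)
  qed
  moreover obtain P where P: "finite P" "P \<subseteq> dyadics" and
    P1: "\<And>x y. x \<le> y \<Longrightarrow> {x..y} \<subseteq> {a..b} \<Longrightarrow> {x<..<y} \<inter> P = {} \<Longrightarrow>
           (\<exists>(k::int). \<exists>c\<in>dyadics. \<forall>t\<in>{x..y}. g t = 2 powi k * t + c)"
    using 1 unfolding dyadic_pl_def by metis
  moreover obtain Q where Q: "finite Q" "Q \<subseteq> dyadics" and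
    Q1: "\<And>x y. x \<le> y \<Longrightarrow> {x..y} \<subseteq> {b..c} \<Longrightarrow> {x<..<y} \<inter> Q = {} \<Longrightarrow>
           (\<exists>(k::int). \<exists>c\<in>dyadics. \<forall>t\<in>{x..y}. g t = 2 powi k * t + c)"
    using 2 unfolding dyadic_pl_def by metis
  have "\<exists>(k::int). \<exists>c\<in>dyadics. \<forall>t\<in>{x..y}. g t = 2 powi k * t + c"
    if "x \<le> y" "{x..y} \<subseteq> {a..c}" "{x<..<y} \<inter> insert b (P \<union> Q) = {}" for x y
  proof -
    have "y \<le> b \<or> b \<le> x" using that(3) by auto
    then show ?thesis
      using P1[of x y] Q1[of x y] that by auto
  qed
  moreover have "finite (insert b (P \<union> Q))" "insert b (P \<union> Q) \<subseteq> dyadics"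
    using P Q b by auto
  ultimately show ?thesis unfolding dyadic_pl_def by metis
qed

text \<open>The one-point interval \<open>{t..t}\<close> has empty interior and so avoids every
  exceptional set, which gives an affine formula with dyadic coefficients at
  \<open>t\<close>.\<close>

lemma dyadic_pl_image:
  assumes "dyadic_pl a b g" "t \<in> {a..b}" "t \<in> dyadics"
  shows "g t \<in> dyadics"
proof -
  obtain k :: int and c where "c \<in> dyadics" "g t = 2 powi k * t + c"
    using assms unfolding dyadic_pl_def
    by (metis atLeastAtMost_singleton empty_subsetI greaterThanLessThan_empty_iff inf_bot_left insert_subset
        order_refl singletonI)
  then show ?thesis using assms(3) by (simp add: dyadics_add dyadics_mult)
qed

section \<open>Affine pieces, breakpoints and slopes\<close>

lemma finite_avoid:
  fixes x :: real
  assumes "finite P"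
  obtains e where "e > 0" "{x<..<x + e} \<inter> P = {}" "{x - e<..<x} \<inter> P = {}"
proof -
  obtain d where "d > 0" "\<forall>p\<in>P. p \<noteq> x \<longrightarrow> d \<le> dist x p"
    using finite_set_avoid[OF assms, of x] by auto
  then show ?thesis by (intro that[of d]) (force simp: dist_real_def)+
qed

text \<open>The point \<open>x\<close> may itself be exceptional: only the open interval to its
  right has to avoid the exceptional set, and a short one does because that set is finite.\<close>

lemma dyadic_pl_right:
  assumes "dyadic_pl a b g" "a \<le> x" "x < b"
  obtains y k c where "x < y" "y \<le> b" "\<And>t. t \<in> {x..y} \<Longrightarrow> g t = 2 powi (k::int) * t + c"
proof -
  obtain P where "finite P" and
    P: "\<And>x y. x \<le> y \<Longrightarrow> {x..y} \<subseteq> {a..b} \<Longrightarrow> {x<..<y} \<inter> P = {} \<Longrightarrow>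
           (\<exists>(k::int). \<exists>c\<in>dyadics. \<forall>t\<in>{x..y}. g t = 2 powi k * t + c)"
    using assms(1) unfolding dyadic_pl_def by metis
  then obtain e where e: "e > 0" "{x<..<x + e} \<inter> P = {}" by (metis finite_avoid)
  have "{x<..<min b (x + e)} \<inter> P = {}" using e by auto
  then show ?thesis
    using P[of x "min b (x + e)"] assms e(1) that[of "min b (x + e)"] by (auto 4 4)
qed

lemma dyadic_pl_left:
  assumes "dyadic_pl a b g" "a < x" "x \<le> b"
  obtains y k c where "y < x" "a \<le> y" "\<And>t. t \<in> {y..x} \<Longrightarrow> g t = 2 powi (k::int) * t + c"
proof -
  obtain P where "finite P" and
    P: "\<And>x y. x \<le> y \<Longrightarrow> {x..y} \<subseteq> {a..b} \<Longrightarrow> {x<..<y} \<inter> P = {} \<Longrightarrow>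
           (\<exists>(k::int). \<exists>c\<in>dyadics. \<forall>t\<in>{x..y}. g t = 2 powi k * t + c)"
    using assms(1) unfolding dyadic_pl_def by metis
  then obtain e where e: "e > 0" "{x - e<..<x} \<inter> P = {}" by (metis finite_avoid)
  have "{max a (x - e)<..<x} \<inter> P = {}" using e by auto
  then show ?thesis
    using P[of "max a (x - e)" x] assms e(1) that[of "max a (x - e)"] by (auto 4 4)
qed

text \<open>Exceptional points are dyadic, so a non-dyadic \<open>x\<close> is not one of them and a
  single affine formula holds on both sides of \<open>x\<close>.\<close>

lemma dyadic_pl_differentiable:
  assumes "dyadic_pl a b g" "a < x" "x < b" "x \<notin> dyadics"
  shows "g differentiable (at x)"
proof -
  obtain P where "finite P" and D: "P \<subseteq> dyadics" and
    P: "\<And>x y. x \<le> y \<Longrightarrow> {x..y} \<subseteq> {a..b} \<Longrightarrow> {x<..<y} \<inter> P = {} \<Longrightarrow>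
           (\<exists>(k::int). \<exists>c\<in>dyadics. \<forall>t\<in>{x..y}. g t = 2 powi k * t + c)"
    using assms(1) unfolding dyadic_pl_def by metis
  then obtain e where e: "e > 0" "{x<..<x + e} \<inter> P = {}" "{x - e<..<x} \<inter> P = {}"
    by (metis finite_avoid)
  define u v where "u = max a (x - e)" and "v = min b (x + e)"
  have uv: "u < x" "x < v" "{u..v} \<subseteq> {a..b}" using assms e(1) by (auto simp: u_def v_def)
  have "{u<..<v} \<subseteq> {x<..<x + e} \<union> {x - e<..<x} \<union> {x}" by (auto simp: u_def v_def)
  moreover have "x \<notin> P" using D assms(4) by auto
  ultimately have "{u<..<v} \<inter> P = {}" using e by blast
  then obtain k :: int and c where kc: "\<And>t. t \<in> {u..v} \<Longrightarrow> g t = 2 powi k * t + c"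
    using P[of u v] uv by (metis less_imp_le less_trans)
  have "((\<lambda>t. 2 powi k * t + c) has_real_derivative 2 powi k) (at x)"
    by (auto intro!: derivative_eq_intros)
  then have "(g has_real_derivative 2 powi k) (at x)"
    by (rule has_field_derivative_transform_within_open[of _ _ _ "{u<..<v}"])
       (use uv kc in auto)
  then show ?thesis by (auto simp: real_differentiable_def)
qed

lemma affine_derivative:
  fixes g :: "real \<Rightarrow> real"
  assumes "(g has_real_derivative d) (at x within I)" "{u..v} \<subseteq> I" "u < v" "x \<in> {u..v}"
    and "\<And>t. t \<in> {u..v} \<Longrightarrow> g t = m * t + c"
  shows "d = m"
proof -
  have "(g has_real_derivative d) (at x within {u..v})"
    using assms(1,2) by (rule DERIV_subset)
  moreover have "((\<lambda>t. m * t + c) has_real_derivative m) (at x within {u..v})"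
    by (auto intro!: derivative_eq_intros)
  then have "(g has_real_derivative m) (at x within {u..v})"
    by (rule has_field_derivative_transform_within[where d = 1]) (use assms in auto)
  \<comment> \<open>Derivatives within a set are unique only at its limit points;
    \<open>u < v\<close> makes \<open>x\<close> one, even if it is an endpoint.\<close>
  moreover have "at x within {u..v} \<noteq> bot"
    using assms(3,4) by (auto simp: trivial_limit_within)
  ultimately show ?thesis by (rule has_field_derivative_unique)
qed

text \<open>The derivative is read off the piece to the right of \<open>x\<close>, or to its left
  when \<open>x = b\<close>. The set \<open>I\<close> is kept general to cover both
  \<open>{0..1}\<close>, with one-sided derivatives at its ends, and the whole line.\<close>

lemma dyadic_pl_slopes:
  assumes "dyadic_pl a b g" "a < b" "{a..b} \<subseteq> I" "x \<in> {a..b}"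
    and "(g has_real_derivative d) (at x within I)"
  shows "\<exists>k::int. d = 2 powi k"
proof (cases "x < b")
  case True
  obtain y c and k :: int where y: "x < y" "y \<le> b" "\<And>t. t \<in> {x..y} \<Longrightarrow> g t = 2 powi k * t + c"
    by (rule dyadic_pl_right[OF assms(1) _ True]) (use assms in auto)
  have "d = 2 powi k"
    by (rule affine_derivative[OF assms(5), of x y, OF _ _ _ y(3)]) (use y assms(3,4) in auto)
  then show ?thesis by blast
next
  case False
  obtain y c and k :: int where y: "y < x" "a \<le> y" "\<And>t. t \<in> {y..x} \<Longrightarrow> g t = 2 powi k * t + c"
    by (rule dyadic_pl_left[OF assms(1), of x]) (use assms False in auto)
  have "d = 2 powi k"
    by (rule affine_derivative[OF assms(5), of y x, OF _ _ _ y(3)]) (use y assms(3,4) in auto)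
  then show ?thesis by blast
qed

lemma dyadic_pl_piecewise_linear:
  assumes "dyadic_pl a b g"
  shows "piecewise_linear_on {a..b} g"
  using assms unfolding dyadic_pl_def piecewise_linear_on_def by metis

(* With 2^k <= (d - c)/(b - a) < 2^(k+1), the slopes 2^(k+1) on an initial segment of length u and
   2^k on the rest give the right total increase for u = (d - c)/2^k - (b - a), which is dyadic. *)
lemma dyadic_pl_exists_segment:
  assumes dy: "a \<in> dyadics" "b \<in> dyadics" "c \<in> dyadics" "d \<in> dyadics" and "a < b" "c < d"
  obtains g where "dyadic_pl a b g" "g a = c" "g b = d"
proof -
  define s where "s = (d - c) / (b - a)"
  define k where "k = \<lfloor>log 2 s\<rfloor>"
  have s: "s > 0" "s * (b - a) = d - c" using assms by (auto simp: s_def)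
  have "2 powr of_int k \<le> s" "s < 2 powr (of_int k + 1)"
    using s by (simp_all add: k_def powr_le_iff less_powr_iff)
  moreover define q :: real where "q = 2 powi k"
  ultimately have k: "q \<le> s" "s < 2 * q"
    by (auto simp: powr_real_of_int' powr_add)
  have q: "q > 0" by (simp add: q_def)
  define u where "u = (d - c) * 2 powi (- k) - (b - a)"
  have uq: "u * q = (d - c) - q * (b - a)"
    unfolding u_def q_def by (simp add: power_int_minus field_simps)
  have "q * (b - a) \<le> s * (b - a)" "s * (b - a) < 2 * q * (b - a)"
    using k assms by (auto intro!: mult_right_mono mult_strict_right_mono)
  then have "0 * q \<le> u * q" "u * q < (b - a) * q"
    unfolding uq s by (simp_all add: algebra_simps)
  \<comment> \<open>The value \<open>u = 0\<close> occurs when the ratio \<open>s\<close> is exactly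
    \<open>2 powi k\<close>; the first piece is then a single point, which gluing permits.\<close>
  then have u: "0 \<le> u" "u < b - a" using q by (simp_all add: zero_le_mult_iff)
  define g where "g t = (if t \<le> a + u then 2 powi (k + 1) * t + (c - 2 powi (k + 1) * a)
                          else 2 powi k * t + (d - 2 powi k * b))" for t
  have du: "a + u \<in> dyadics" unfolding u_def using dy
    by (intro dyadics_add dyadics_diff dyadics_mult dyadics_two_powi)
  \<comment> \<open>At \<open>a + u\<close> the map \<open>g\<close> uses the first formula, so
    agreement of the formulas there is what lets the second piece include its left endpoint.\<close>
  have eq: "2 powi (k + 1) * (a + u) + (c - 2 powi (k + 1) * a) = 2 powi k * (a + u) + (d - 2 powi k * b)"
    using uq by (simp add: power_int_add q_def algebra_simps)
  have dc: "c - 2 powi (k + 1) * a \<in> dyadics" "d - 2 powi k * b \<in> dyadics"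
    using dy by (intro dyadics_diff dyadics_mult dyadics_two_powi; simp)+
  have "dyadic_pl a (a + u) g"
    by (rule dyadic_pl_cong[OF dyadic_pl_affine[of "c - 2 powi (k + 1) * a" _ _ "k + 1"]])
       (use dc in \<open>auto simp: g_def\<close>)
  moreover have "dyadic_pl (a + u) b g"
    by (rule dyadic_pl_cong[OF dyadic_pl_affine[of "d - 2 powi k * b" _ _ k]])
       (use dc eq in \<open>auto simp: g_def\<close>)
  ultimately have "dyadic_pl a b g"
    by (rule dyadic_pl_glue) (use u du in auto)
  moreover have "g a = c" "g b = d" using u by (auto simp: g_def)
  ultimately show ?thesis using that by blast
qed

section \<open>Interpolation of dyadic data and uniform approximation\<close>

text \<open>Segments are glued one at a time. The inequality is carried through the induction
  because gluing needs the endpoints in order.\<close>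

lemma dyadic_pl_exists_chain:
  fixes x y :: "nat \<Rightarrow> real"
  assumes "\<And>i. i \<le> n \<Longrightarrow> x i \<in> dyadics \<and> y i \<in> dyadics"
    and "\<And>i. i < n \<Longrightarrow> x i < x (Suc i) \<and> y i < y (Suc i)"
  shows "x 0 \<le> x n \<and> (\<exists>g. dyadic_pl (x 0) (x n) g \<and> (\<forall>i\<le>n. g (x i) = y i))"
  using assms
proof (induction n)
  case 0
  then have "dyadic_pl (x 0) (x 0) (\<lambda>t. 2 powi 0 * t + (y 0 - x 0))"
    by (intro dyadic_pl_affine dyadics_diff) auto
  then show ?case by (auto intro!: exI[of _ "\<lambda>t. 2 powi 0 * t + (y 0 - x 0)"])
next
  case (Suc n)
  then obtain g where g: "dyadic_pl (x 0) (x n) g" "\<forall>i\<le>n. g (x i) = y i" and le: "x 0 \<le> x n"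
    by auto
  obtain h where h: "dyadic_pl (x n) (x (Suc n)) h" "h (x n) = y n" "h (x (Suc n)) = y (Suc n)"
    using dyadic_pl_exists_segment[of "x n" "x (Suc n)" "y n" "y (Suc n)"] Suc.prems
    by (metis le_SucI lessI order_refl)
  define f where "f t = (if t \<le> x n then g t else h t)" for t
  have lt: "x n < x (Suc n)" using Suc.prems by auto
  \<comment> \<open>Earlier grid points lie in the part where \<open>f\<close> is \<open>g\<close>,
    so their values survive the extension.\<close>
  have inc: "x i \<le> x n" if "i \<le> n" for i
    using that
  proof (induction rule: inc_induct)
    case (step m)
    then show ?case using Suc.prems(2)[of m] by auto
  qed simp
  have "dyadic_pl (x 0) (x n) f"
    by (rule dyadic_pl_cong[OF g(1)]) (auto simp: f_def)
  moreover have "dyadic_pl (x n) (x (Suc n)) f"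
    by (rule dyadic_pl_cong[OF h(1)]) (use g(2) h(2) in \<open>auto simp: f_def\<close>)
  ultimately have "dyadic_pl (x 0) (x (Suc n)) f"
    by (rule dyadic_pl_glue) (use le lt Suc.prems(1)[of n] in auto)
  moreover have "f (x i) = y i" if "i \<le> Suc n" for i
  proof (cases "i = Suc n")
    case True
    then show ?thesis using lt h by (auto simp: f_def)
  next
    case False
    then show ?thesis using inc[of i] g that by (auto simp: f_def)
  qed
  ultimately show ?case using le lt by auto
qed

text \<open>On \<open>{x i..x (i + 1)}\<close> both functions take values between
  \<open>f (x (i - 1))\<close> and \<open>f (x (i + 1))\<close>, and uniform continuity makes that
  range shorter than \<epsilon>. The end values are kept exactly, so that \<open>g\<close> can serve
  as a homeomorphism of \<open>{0..1}\<close> or be extended periodically.\<close>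

lemma dyadic_pl_approx:
  fixes f :: "real \<Rightarrow> real"
  assumes cont: "continuous_on {0..1} f" and mono: "strict_mono_on {0..1} f"
    and dy: "f 0 \<in> dyadics" "f 1 \<in> dyadics" and "\<epsilon> > 0"
  obtains g where "dyadic_pl 0 1 g" "g 0 = f 0" "g 1 = f 1" "\<And>t. t \<in> {0..1} \<Longrightarrow> \<bar>f t - g t\<bar> < \<epsilon>"
proof -
  have "uniformly_continuous_on {0..1} f"
    using cont by (intro compact_uniformly_continuous) auto
  then obtain \<delta> where \<delta>: "\<delta> > 0" "\<And>s t. s \<in> {0..1} \<Longrightarrow> t \<in> {0..1} \<Longrightarrow> dist s t < \<delta> \<Longrightarrow> dist (f s) (f t) < \<epsilon>"
    using \<open>\<epsilon> > 0\<close> unfolding uniformly_continuous_on_def by metis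
  \<comment> \<open>The factor 2 is there because the comparison spans two adjacent grid
    cells.\<close>
  obtain n where "2 / \<delta> < 2 ^ n" using real_arch_pow[of 2 "2 / \<delta>"] by auto
  then have n: "2 / 2 ^ n < \<delta>" using \<delta>(1) by (simp add: field_simps)
  define N :: nat where "N = 2 ^ n"
  have N: "N > 0" "real N = 2 ^ n" by (simp_all add: N_def)
  define x where "x i = real i / real N" for i
  have x01: "x i \<in> {0..1}" if "i \<le> N" for i using that N(1) by (simp add: x_def)
  have x0: "x 0 = 0" and xN: "x N = 1" using N(1) by (auto simp: x_def)
  have xdy: "x i \<in> dyadics" for i
    by (rule dyadicsI[of _ "int i" n]) (simp add: x_def N)
  have xlt: "x i < x j" if "i < j" for i j using that N(1) by (simp add: x_def divide_strict_right_mono)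
  have flt: "f (x i) < f (x j)" if "i < j" "j \<le> N" for i j
    using x01[of i] x01[of j] xlt[of i j] that by (intro strict_mono_on_Icc_less[OF mono]) auto
  have "\<exists>d. d \<in> dyadics \<and> f (x i) < d \<and> d < f (x (Suc i))" if "i < N" for i
    using dyadics_dense[OF flt[of i "Suc i"]] that by auto
  then obtain z where z: "\<And>i. i < N \<Longrightarrow> z i \<in> dyadics \<and> f (x i) < z i \<and> z i < f (x (Suc i))"
    by metis
  \<comment> \<open>Interior values lag one cell behind \<open>f\<close>: \<open>y i\<close> lies
    strictly between \<open>f (x (i - 1))\<close> and \<open>f (x i)\<close>. Hence
    \<open>y i \<le> f (x i) < y (Suc i)\<close> for interior \<open>i\<close>, giving strict
    increase.\<close>
  define y where "y i = (if i = 0 then f 0 else if i = N then f 1 else z (i - 1))" for i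
  have ydy: "y i \<in> dyadics" if "i \<le> N" for i
    using that dy z[of "i - 1"] by (auto simp: y_def)
  have yup: "y i \<le> f (x i)" if "i \<le> N" for i
    using that z[of "i - 1"] by (auto simp: y_def x0 xN intro!: less_imp_le)
  \<comment> \<open>For \<open>i = 0\<close> truncated subtraction gives \<open>i - 1 = 0\<close>,
    and the bound is an equality.\<close>
  have ylow: "f (x (i - 1)) \<le> y i" if "i \<le> N" for i
    using that z[of "i - 1"] flt[of "N - 1" N] N(1) by (auto simp: y_def x0 xN intro!: less_imp_le)
  have ylt: "y i < y (Suc i)" if "i < N" for i
  proof -
    have "f (x i) < y (Suc i)"
      using that z[of i] flt[of i N] by (auto simp: y_def xN)
    then show ?thesis using yup[of i] that by auto
  qed
  obtain g where g: "dyadic_pl 0 1 g" "\<And>i. i \<le> N \<Longrightarrow> g (x i) = y i"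
    using dyadic_pl_exists_chain[of N x y] xdy ydy xlt ylt unfolding x0 xN by auto
  have "\<bar>f t - g t\<bar> < \<epsilon>" if t: "t \<in> {0..1}" for t
  proof -
    obtain i where i: "i < N" "x i \<le> t" "t \<le> x (Suc i)"
    \<comment> \<open>The floor of \<open>t * N\<close> would give the index \<open>N\<close> at
      \<open>t = 1\<close>, so the last cell is chosen by hand there.\<close>
    proof (cases "t = 1")
      case True
      then show ?thesis using N(1) x01[of "N - 1"] xN by (intro that[of "N - 1"]) auto
    next
      case False
      define i where "i = nat \<lfloor>t * N\<rfloor>"
      have "t * N < N" "0 \<le> t * N" using t False N(1) by auto
      then have "i < N" "real i \<le> t * N" "t * N \<le> real (Suc i)"
        unfolding i_def by linarith+
      then show ?thesis using N(1) by (intro that[of i]) (auto simp: x_def field_simps)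
    qed
    have "g (x i) \<le> g t" "g t \<le> g (x (Suc i))"
      using strict_mono_on_Icc_le[OF dyadic_pl_strict_mono[OF g(1)]] i t x01[of i] x01[of "Suc i"] by auto
    then have gt: "f (x (i - 1)) \<le> g t" "g t \<le> f (x (Suc i))"
      using ylow[of i] yup[of "Suc i"] g(2) i(1) by auto
    have fmono: "f u \<le> f v" if "u \<in> {0..1}" "v \<in> {0..1}" "u \<le> v" for u v
      using that by (intro strict_mono_on_Icc_le[OF mono]) auto
    have "x (i - 1) \<le> x i" by (simp add: x_def divide_right_mono)
    then have ft: "f (x (i - 1)) \<le> f t" "f t \<le> f (x (Suc i))"
      using fmono x01[of "i - 1"] x01[of "Suc i"] i t by auto
    have "x (Suc i) - x (i - 1) \<le> 2 / 2 ^ n"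
      using N by (cases i) (simp_all add: x_def field_simps)
    moreover have "x (i - 1) < x (Suc i)" by (rule xlt) auto
    ultimately have "dist (f (x (Suc i))) (f (x (i - 1))) < \<epsilon>"
      using x01[of "Suc i"] x01[of "i - 1"] i(1) n by (intro \<delta>(2)) (auto simp: dist_real_def)
    then show ?thesis using gt ft by (auto simp: dist_real_def)
  qed
  then show ?thesis
    using that[of g] g(1) g(2)[of 0] g(2)[of N] N(1) by (auto simp: x0 xN y_def)
qed

section \<open>Approximation on the interval by elements of \<open>thompson_F\<close>\<close>

text \<open>A strict pointwise bound passes to the supremum only as a weak one; halving \<epsilon>
  restores strictness.\<close>

lemma sup_norm_on_less:
  assumes "\<epsilon> > 0" "\<And>t. t \<in> {0..1} \<Longrightarrow> \<bar>h t\<bar> < \<epsilon> / 2"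
  shows "sup_norm_on {0..1} h < \<epsilon>"
proof -
  have "sup_norm_on {0..1} h \<le> \<epsilon> / 2"
    unfolding sup_norm_on_def using assms(2) by (intro cSUP_least) (auto intro: less_imp_le)
  then show ?thesis using assms(1) by simp
qed

lemma dyadic_pl_in_thompson_F:
  assumes g: "dyadic_pl 0 1 g" and "g 0 = 0" "g 1 = 1"
  shows "g \<in> thompson_F"
proof -
  have cont: "continuous_on {0..1} g" and mono: "strict_mono_on {0..1} g"
    using g by (auto simp: dyadic_pl_def)
  have inj: "inj_on g {0..1}" using mono by (rule strict_mono_on_imp_inj_on)
  have "g ` {0..1} = {0..1}"
  proof
    show "g ` {0..1} \<subseteq> {0..1}"
      using strict_mono_on_Icc_le[OF mono] assms by fastforce
    show "{0..1} \<subseteq> g ` {0..1}"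
      using IVT'[of g 0 _ 1] cont assms by fastforce
  qed
  then have "homeomorphism {0..1} {0..1} g (inv_into {0..1} g)"
    using cont inj continuous_on_inv[OF cont, of "inv_into {0..1} g"]
      bij_betw_imp_surj_on[OF bij_betw_inv_into[OF inj_on_imp_bij_betw[OF inj]]]
    by (auto simp: homeomorphism_def f_inv_into_f)
  moreover have "breakpoints {0..1} g \<subseteq> dyadics"
  proof
    fix x assume x: "x \<in> breakpoints {0..1} g"
    show "x \<in> dyadics"
    proof (rule ccontr)
      assume nd: "x \<notin> dyadics"
      \<comment> \<open>The endpoints are dyadic, so \<open>x\<close> is interior and has a
        two-sided derivative.\<close>
      then have "x \<noteq> 0" "x \<noteq> 1" by auto
      then have "g differentiable (at x)"
        using x nd by (intro dyadic_pl_differentiable[OF g]) (auto simp: breakpoints_def)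
      then show False
        using x by (auto simp: breakpoints_def intro: differentiable_at_withinI)
    qed
  qed
  moreover have "power_of_two_slopes_on {0..1} g"
    unfolding power_of_two_slopes_on_def using dyadic_pl_slopes[OF g, of "{0..1}"] by auto
  ultimately show ?thesis
    using mono dyadic_pl_piecewise_linear[OF g] by (auto simp: thompson_F_def homeo_plus_interval_def)
qed

lemma thompson_F_dense:
  assumes "f \<in> homeo_plus_interval" "\<epsilon> > 0"
  shows "\<exists>g\<in>thompson_F. sup_norm_on {0..1} (\<lambda>x. f x - g x) < \<epsilon>"
proof -
  have cont: "continuous_on {0..1} f" and mono: "strict_mono_on {0..1} f" and im: "f ` {0..1} = {0..1}"
    using assms(1) by (auto simp: homeo_plus_interval_def homeomorphism_def)
  have fmono: "f u \<le> f v" if "u \<in> {0..1}" "v \<in> {0..1}" "u \<le> v" for u v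
    using that by (intro strict_mono_on_Icc_le[OF mono]) auto
  \<comment> \<open>An increasing surjection of \<open>{0..1}\<close> fixes the endpoints:
    \<open>f 0 \<le> f u = 0\<close> and \<open>1 = f v \<le> f 1\<close>. The end values are
    therefore dyadic.\<close>
  have "0 \<in> f ` {0..1}" "1 \<in> f ` {0..1}" unfolding im by auto
  then obtain u v where "u \<in> {0..1}" "f u = 0" "v \<in> {0..1}" "f v = 1" by fastforce
  moreover have "f 0 \<in> {0..1}" "f 1 \<in> {0..1}" using im by auto
  ultimately have f01: "f 0 = 0" "f 1 = 1"
    using fmono[of 0 u] fmono[of v 1] by auto
  have "f 0 \<in> dyadics" "f 1 \<in> dyadics" "\<epsilon> / 2 > 0" using f01 assms(2) by auto
  with cont mono obtain g where "dyadic_pl 0 1 g" "g 0 = f 0" "g 1 = f 1"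
      "\<And>t. t \<in> {0..1} \<Longrightarrow> \<bar>f t - g t\<bar> < \<epsilon> / 2"
    by (rule dyadic_pl_approx) blast
  then show ?thesis
    using f01 assms(2) by (intro bexI[of _ g] sup_norm_on_less dyadic_pl_in_thompson_F) auto
qed

section \<open>Periodic extension and approximation on the circle by elements of
  \<open>thompson_T\<close>\<close>

lemma periodic_of_int:
  fixes G :: "real \<Rightarrow> real"
  assumes "\<And>x. G (x + 1) = G x + 1"
  shows "G (x + of_int m) = G x + of_int m"
proof (induction m rule: int_induct[where k = 0])
  case (step1 i)
  then show ?case using assms[of "x + of_int i"] by (simp add: algebra_simps)
next
  case (step2 i)
  then show ?case using assms[of "x + of_int i - 1"] by (simp add: algebra_simps)
qed simp

text \<open>Since \<open>G\<close> commutes with integer translations, the exceptional set moves by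
  \<open>m\<close> and a constant term \<open>c\<close> becomes \<open>c - 2 powi k * m + m\<close>,
  which is still dyadic.\<close>

lemma dyadic_pl_translate:
  assumes g: "dyadic_pl a b G" and per: "\<And>x. G (x + 1) = G x + 1"
  shows "dyadic_pl (a + of_int m) (b + of_int m) G"
proof -
  have G: "G t = G (t - of_int m) + of_int m" for t
    using periodic_of_int[of G "t - of_int m" m] per by simp
  obtain P where P: "finite P" "P \<subseteq> dyadics" and
    P1: "\<And>x y. x \<le> y \<Longrightarrow> {x..y} \<subseteq> {a..b} \<Longrightarrow> {x<..<y} \<inter> P = {} \<Longrightarrow>
           (\<exists>(k::int). \<exists>c\<in>dyadics. \<forall>t\<in>{x..y}. G t = 2 powi k * t + c)"
    using g unfolding dyadic_pl_def by metis
  have "continuous_on {a..b} G" using g by (simp add: dyadic_pl_def)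
  then have "continuous_on {a + of_int m..b + of_int m} (\<lambda>t. G (t - of_int m))"
    by (rule continuous_on_compose2) (auto intro!: continuous_on_diff continuous_on_id continuous_on_const)
  then have "continuous_on {a + of_int m..b + of_int m} (\<lambda>t. G (t - of_int m) + of_int m)"
    by (rule continuous_on_add[OF _ continuous_on_const])
  then have "continuous_on {a + of_int m..b + of_int m} G"
    by (subst continuous_on_cong[OF refl G])
  moreover have "strict_mono_on {a + of_int m..b + of_int m} G"
  proof (rule strict_mono_onI)
    fix r s assume "r \<in> {a + of_int m..b + of_int m}" "s \<in> {a + of_int m..b + of_int m}" "r < s"
    then have "G (r - of_int m) < G (s - of_int m)"
      by (intro strict_mono_on_Icc_less[OF dyadic_pl_strict_mono[OF g]]) auto
    then show "G r < G s" using G[of r] G[of s] by simp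
  qed
  moreover have "\<exists>(k::int). \<exists>c\<in>dyadics. \<forall>t\<in>{x..y}. G t = 2 powi k * t + c"
    if xy: "x \<le> y" "{x..y} \<subseteq> {a + of_int m..b + of_int m}" "{x<..<y} \<inter> (\<lambda>p. p + of_int m) ` P = {}" for x y
  proof -
    have "{x - of_int m<..<y - of_int m} \<inter> P = {}"
    proof (rule ccontr)
      assume "{x - of_int m<..<y - of_int m} \<inter> P \<noteq> {}"
      then obtain p where "p \<in> P" "x < p + of_int m" "p + of_int m < y" by (auto simp: algebra_simps)
      then show False using xy(3) by auto
    qed
    moreover have "{x - of_int m..y - of_int m} \<subseteq> {a..b}" using xy by auto
    ultimately obtain k :: int and c where
      c: "c \<in> dyadics" "\<And>t. t \<in> {x - of_int m..y - of_int m} \<Longrightarrow> G t = 2 powi k * t + c"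
      using P1[of "x - of_int m" "y - of_int m"] xy(1) by (meson diff_right_mono)
    have "G t = 2 powi k * t + (c - 2 powi k * of_int m + of_int m)" if "t \<in> {x..y}" for t
      using c(2)[of "t - of_int m"] G[of t] that by (simp add: algebra_simps)
    moreover have "c - 2 powi k * of_int m + of_int m \<in> dyadics"
      using c(1) by (intro dyadics_add dyadics_diff dyadics_mult dyadics_two_powi dyadics_of_int)
    ultimately show ?thesis by blast
  qed
  moreover have "finite ((\<lambda>p. p + of_int m) ` P)" "(\<lambda>p. p + of_int m) ` P \<subseteq> dyadics"
    using P by (auto intro: dyadics_add)
  ultimately show ?thesis unfolding dyadic_pl_def by metis
qed

text \<open>Unit intervals are glued at the integers up to \<open>2 * n\<close>, and the result is
  shifted by \<open>- n\<close>. Bounded intervals are used because a lift may have infinitely many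
  breakpoints on the line.\<close>

lemma dyadic_pl_periodic:
  assumes "dyadic_pl 0 1 G" and per: "\<And>x. G (x + 1) = G x + 1"
  shows "dyadic_pl (- real n) (real n) G"
proof -
  have "dyadic_pl 0 (real n) G" for n
  proof (induction n)
    case 0
    have "dyadic_pl 0 0 (\<lambda>t. 2 powi 0 * t + G 0)"
      using dyadic_pl_image[OF assms(1), of 0] by (intro dyadic_pl_affine) auto
    then have "dyadic_pl 0 0 G" by (rule dyadic_pl_cong) auto
    then show ?case by simp
  next
    case (Suc n)
    have "dyadic_pl (real n) (real (Suc n)) G"
      using dyadic_pl_translate[OF assms(1) per, of "int n"] by simp
    with Suc show ?case
      by (rule dyadic_pl_glue) (use dyadics_of_int[of "int n"] in auto)
  qed
  from dyadic_pl_translate[OF this[of "2 * n"] per, of "- int n"] show ?thesis by simp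
qed

text \<open>The values \<open>G 0 + n\<close> and \<open>G 0 - n\<close> at \<open>n\<close> and
  \<open>- n\<close> are unbounded in both directions, so the intermediate value theorem gives
  surjectivity. Invariance of domain gives continuity of the inverse.\<close>

lemma homeomorphism_UNIV_periodic:
  fixes G :: "real \<Rightarrow> real"
  assumes cont: "continuous_on UNIV G" and "strict_mono G" and per: "\<And>x. G (x + 1) = G x + 1"
  shows "homeomorphism UNIV UNIV G (inv G)"
proof -
  have inj: "inj G" using assms(2) by (rule strict_mono_imp_inj_on)
  have "\<exists>x. G x = y" for y
  proof -
    obtain n where n: "\<bar>y - G 0\<bar> \<le> real n" using real_arch_simple by blast
    have "G (- real n) \<le> y" "y \<le> G (real n)"
      using n periodic_of_int[of G 0 "int n"] periodic_of_int[of G 0 "- int n"] per by auto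
    moreover have "continuous_on {- real n..real n} G"
      using cont by (rule continuous_on_subset) auto
    ultimately show ?thesis using IVT'[of G "- real n" y "real n"] by auto
  qed
  then have surj: "surj G" by (metis surjI)
  obtain h where h: "homeomorphism UNIV (G ` UNIV) G h"
    using invariance_of_domain_homeomorphism[OF open_UNIV cont _ inj] by auto
  then have "h = inv G"
    using surj by (auto simp: homeomorphism_def intro!: inv_unique_comp[symmetric])
  then show ?thesis using h surj by simp
qed

lemma thompson_T_dense:
  assumes "circle_lift f F" "\<epsilon> > 0"
  shows "\<exists>g\<in>thompson_T. circle_C0_close f g \<epsilon>"
proof -
  have cont: "continuous_on UNIV F" and inj: "inj F" and per: "\<And>x. F (x + 1) = F x + 1"
    using assms(1) unfolding circle_lift_def homeomorphism_def by (auto intro: inj_on_inverseI)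
  have mono: "F x < F y" if "x < y" for x y
  proof -
    obtain n :: nat where n: "y < x + real n"
      using reals_Archimedean2[of "y - x"] by (auto simp: algebra_simps)
    have "continuous_on {x..x + real n} F" "inj_on F {x..x + real n}"
      using cont inj by (auto intro: continuous_on_subset inj_on_subset)
    \<comment> \<open>A continuous injection is monotone on the interval; the decreasing alternative
      contradicts \<open>F (x + n) = F x + n\<close>.\<close>
    then have "F x < F y \<and> F y < F (x + real n) \<or> F x > F y \<and> F y > F (x + real n)"
      using continuous_inj_imp_mono[of x y "x + real n" F] n that by auto
    then show ?thesis using periodic_of_int[of F x "int n"] per by auto
  qed
  \<comment> \<open>The translation costs less than \<open>\<epsilon> / 4\<close> and the
    approximation of \<open>E\<close> another \<open>\<epsilon> / 4\<close>, leaving the bound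
    \<open>\<epsilon> / 2\<close> that \<open>sup_norm_on_less\<close> asks for.\<close>
  obtain d where d: "d \<in> dyadics" "F 0 < d" "d < F 0 + \<epsilon> / 4"
    using dyadics_dense[of "F 0" "F 0 + \<epsilon> / 4"] assms(2) by auto
  define E where "E x = F x + (d - F 0)" for x
  have E01: "E 0 = d" "E 1 = d + 1" using per[of 0] by (simp_all add: E_def)
  have "continuous_on {0..1} E" unfolding E_def
    by (intro continuous_intros continuous_on_subset[OF cont]) auto
  moreover have "strict_mono_on {0..1} E" by (auto simp: E_def strict_mono_on_def mono)
  moreover have "E 0 \<in> dyadics" "E 1 \<in> dyadics" "\<epsilon> / 4 > 0"
    using d(1) assms(2) by (auto simp: E01 intro: dyadics_add)
  ultimately obtain g where g: "dyadic_pl 0 1 g" "g 0 = E 0" "g 1 = E 1"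
      "\<And>t. t \<in> {0..1} \<Longrightarrow> \<bar>E t - g t\<bar> < \<epsilon> / 4"
    by (rule dyadic_pl_approx) blast
  define G where "G x = g (frac x) + of_int \<lfloor>x\<rfloor>" for x
  have Gper: "G (x + 1) = G x + 1" for x by (simp add: G_def frac_def)
  \<comment> \<open>At \<open>t = 1\<close> the definition gives \<open>g 0 + 1\<close>, which is
    \<open>g 1\<close> because \<open>g\<close> keeps the end values of \<open>E\<close>.\<close>
  have Gg: "G t = g t" if "t \<in> {0..1}" for t
  proof (cases "t = 1")
    case False
    then have "\<lfloor>t\<rfloor> = 0" "frac t = t" using that by (auto simp: floor_eq_iff frac_eq)
    then show ?thesis by (simp add: G_def)
  qed (simp add: G_def g E01)
  have G1: "dyadic_pl 0 1 G" by (rule dyadic_pl_cong[OF g(1) Gg])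
  note Gn = dyadic_pl_periodic[OF G1 Gper]
  have ex: "\<exists>n. - real n < x \<and> x < real n" for x
    using reals_Archimedean2[of "\<bar>x\<bar>"] by (metis abs_less_iff minus_less_iff)
  have "isCont G x" for x
  proof -
    obtain n where "- real n < x" "x < real n" using ex by blast
    moreover have "continuous_on {- real n..real n} G" using Gn[of n] by (simp add: dyadic_pl_def)
    ultimately show ?thesis by (intro continuous_on_interior[of "{- real n..real n}"]) auto
  qed
  then have contG: "continuous_on UNIV G" by (simp add: continuous_at_imp_continuous_on)
  have monoG: "strict_mono G"
  proof (rule strict_monoI)
    fix x y :: real assume "x < y"
    obtain n where "- real n < - (\<bar>x\<bar> + \<bar>y\<bar>)" using ex by blast
    then show "G x < G y"
      using \<open>x < y\<close> by (intro strict_mono_on_Icc_less[OF dyadic_pl_strict_mono[OF Gn[of n]]]) auto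
  qed
  \<comment> \<open>The choice of representative is harmless: another one differs by an integer,
    with which \<open>G\<close> commutes, so \<open>G\<close> is a lift of \<open>h\<close>.\<close>
  define h where "h c = to_circle (G (rep_circle c))" for c
  have "h (to_circle x) = to_circle (G x)" for x
  proof -
    have "rep_circle (to_circle x) - x \<in> \<int>"
      using Quotient3_rep_abs[OF Quotient3_circle] circle.abs_eq_iff by blast
    then obtain m where "rep_circle (to_circle x) = x + of_int m"
      by (metis Ints_cases diff_add_cancel add.commute)
    then show ?thesis
      using periodic_of_int[of G x m] Gper by (simp add: h_def circle.abs_eq_iff)
  qed
  then have lift: "circle_lift h G"
    using homeomorphism_UNIV_periodic[OF contG monoG Gper] Gper by (simp add: circle_lift_def)
  have "breakpoints UNIV G \<subseteq> dyadics"
  proof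
    fix x assume x: "x \<in> breakpoints UNIV G"
    obtain n where "- real n < x" "x < real n" using ex by blast
    then show "x \<in> dyadics"
      using dyadic_pl_differentiable[OF Gn] x by (auto simp: breakpoints_def)
  qed
  moreover have "G ` dyadics \<subseteq> dyadics"
  proof
    fix y assume "y \<in> G ` dyadics"
    then obtain x where x: "y = G x" "x \<in> dyadics" by blast
    obtain n where "- real n < x" "x < real n" using ex by blast
    then show "y \<in> dyadics" using dyadic_pl_image[OF Gn, of x n] x by auto
  qed
  moreover have "power_of_two_slopes_on UNIV G"
    unfolding power_of_two_slopes_on_def
  proof (intro ballI allI impI)
    fix x e assume D: "(G has_real_derivative e) (at x within UNIV)"
    obtain n where n: "- real n < x" "x < real n" using ex by blast
    show "\<exists>k::int. e = 2 powi k"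
      by (rule dyadic_pl_slopes[OF Gn _ _ _ D, of n]) (use n in auto)
  qed
  ultimately have "h \<in> thompson_T"
    using lift dyadic_pl_piecewise_linear[OF G1] by (auto simp: thompson_T_def)
  moreover have "circle_C0_close f h \<epsilon>"
    unfolding circle_C0_close_def
  proof (intro exI conjI)
    show "sup_norm_on {0..1} (\<lambda>x. F x - G x) < \<epsilon>"
    proof (rule sup_norm_on_less)
      fix t :: real assume t: "t \<in> {0..1}"
      show "\<bar>F t - G t\<bar> < \<epsilon> / 2"
        using g(4)[OF t] d(2,3) unfolding Gg[OF t] E_def by linarith
    qed fact
  qed (fact assms(1) lift)+
  ultimately show ?thesis by blast
qed

theorem theorem4p16:
  "(\<forall>f \<in> diff1_plus_interval. \<forall>\<epsilon>::real. \<epsilon> > 0 \<longrightarrow>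
      (\<exists>g \<in> thompson_F. sup_norm_on {0..1} (\<lambda>x. f x - g x) < \<epsilon>)) \<and>
   (\<forall>f \<in> diff1_plus_circle. \<forall>\<epsilon>::real. \<epsilon> > 0 \<longrightarrow>
      (\<exists>g \<in> thompson_T. circle_C0_close f g \<epsilon>))"
  unfolding diff1_plus_interval_def diff1_plus_circle_def
  using thompson_F_dense thompson_T_dense by blast

end
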